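(* For every $n\in\mathbb N$ and every $2$-colouring of the edges of the complete $3$-uniform hypergraph $\mathcal K^{(3)}_n$ on $n$ vertices, there is a spanning bicoloured tight path.
   Context: The edges of $\mathcal K^{(3)}_n$ are all $3$-element subsets of an $n$-element vertex set. A tight path $P=v_1v_2\ldots v_k$ is an ordered sequence of distinct vertices such that every three consecutive vertices form an edge; its edges are the triples $v_{i-1}v_iv_{i+1}$ with $2\le i\le k-1$. It is spanning if it contains all $n$ vertices. Given a $2$-colouring of the edges of $\mathcal K^{(3)}_n$, a tight path $P=v_1v_2\ldots v_k$ is called bicoloured if there is an index $\ell\in\{1,\ldots,k-1\}$ such that all edges $v_{i-1}v_iv_{i+1}$ of $P$ with $2\le i\le \ell$ have the same colour, and all other edges of $P$ have the other colour. (In particular monochromatic tight paths are bicoloured, by taking $\ell=1$ or $\ell=k-1$.) In the degenerate case $k=1$, a single vertex is regarded as a bicoloured tight path. *)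

theory Defs
  imports Main "HOL-Library.Ramsey"
begin

text \<open>A sequence \<open>v\<^sub>1 \<dots> v\<^sub>k\<close> is a list \<open>p\<close> of length \<open>k\<close> with \<open>v\<^sub>i = p ! (i - 1)\<close>.\<close>

definition path_edge :: "'a list \<Rightarrow> nat \<Rightarrow> 'a set" where
  "path_edge p i = {p ! (i - 2), p ! (i - 1), p ! i}"
  \<comment> \<open>the triple \<open>v\<^bsub>i-1\<^esub> v\<^sub>i v\<^bsub>i+1\<^esub>\<close>, only meaningful for \<open>2 \<le> i \<le> k - 1\<close>\<close>

definition tight_path :: "'a set \<Rightarrow> 'a set set \<Rightarrow> 'a list \<Rightarrow> bool" where
  "tight_path V E p \<longleftrightarrow>
     p \<noteq> [] \<and> distinct p \<and> set p \<subseteq> V \<and> (\<forall>i\<in>{2..length p - 1}. path_edge p i \<in> E)"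

definition spanning :: "'a set \<Rightarrow> 'a list \<Rightarrow> bool" where
  "spanning V p \<longleftrightarrow> set p = V"

definition complete3_edges :: "'a set \<Rightarrow> 'a set set" where
  "complete3_edges V = nsets V 3"

text \<open>The two colours are the elements of \<^typ>\<open>bool\<close>, so the colour other than \<open>b\<close> is \<open>\<not> b\<close>;
  the values of a colouring on sets that are not edges are never used.
  The first disjunct is needed because \<open>{1..k - 1}\<close> is empty for \<open>k = 1\<close>.\<close>

definition bicoloured :: "('a set \<Rightarrow> bool) \<Rightarrow> 'a list \<Rightarrow> bool" where
  "bicoloured c p \<longleftrightarrow>
     length p = 1 \<or>
     (\<exists>l\<in>{1..length p - 1}. \<exists>b.
        (\<forall>i\<in>{2..l}. c (path_edge p i) = b) \<and>
        (\<forall>i\<in>{l<..length p - 1}. c (path_edge p i) = (\<not> b)))"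

end

theory Submission
  imports Defs "HOL-Library.Multiset"
begin

text \<open>
  By induction on the vertex set it suffices to insert one more vertex \<open>x\<close> into a bicoloured path
  \<open>s A a b B t\<close>, where \<open>s A a b\<close> is red and \<open>a b B t\<close> is blue. Up to reversing the path and swapping
  the colours, \<open>a b x\<close> is red. The cases where \<open>s A\<close> or \<open>B\<close> is empty are easy. Otherwise let \<open>p\<close> be the
  successor of \<open>s\<close>, \<open>q\<close> the first vertex of \<open>B\<close> and \<open>w\<close> the last one, and write \<open>A\<^sup>-\<close>, \<open>B\<^sup>-\<close> for
  the reversed sequences. If none of the following sequences is bicoloured, then one after the other
  they determine colours:

  \<open>x s A a b B t\<close>: \<open>x s p\<close> is blue;
  \<open>x b a A\<^sup>- s t B\<^sup>-\<close>: \<open>p s t\<close> is blue and \<open>s t w\<close> is red;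
  \<open>s A a b x B t\<close>: \<open>b x q\<close> is blue;
  \<open>s A a b x t B\<^sup>-\<close>: \<open>b x t\<close> is blue;
  \<open>a A\<^sup>- s x b B t\<close>: \<open>s x b\<close> is red;
  \<open>A a b x s t B\<^sup>-\<close>: \<open>x s t\<close> is blue.

  But then \<open>a A\<^sup>- s t x b B\<close> is bicoloured.
\<close>

section \<open>Monochromatic sequences\<close>

fun mono_path :: "('a set \<Rightarrow> bool) \<Rightarrow> bool \<Rightarrow> 'a list \<Rightarrow> bool" where
  "mono_path c k (u # v # w # p) \<longleftrightarrow> c {u, v, w} = k \<and> mono_path c k (v # w # p)"
| "mono_path c k _ \<longleftrightarrow> True"

text \<open>Two parts that overlap in exactly two vertices split the triples: each triple lies
  wholly in one part.\<close>

lemma mono_path_append: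
  "mono_path c k (xs @ u # v # ys) \<longleftrightarrow> mono_path c k (xs @ [u, v]) \<and> mono_path c k (u # v # ys)"
proof (induction xs)
  case (Cons x xs)
  then show ?case
    by (cases xs rule: remdups_adj.cases) auto
qed simp

lemma mono_path_rev: "mono_path c k (rev p) \<longleftrightarrow> mono_path c k p"
proof (induction c k p rule: mono_path.induct)
  case (1 c k u v w p)
  then show ?case
    using mono_path_append[of c k "rev p @ [w]" v u "[]"] mono_path_append[of c k "rev p" w v "[u]"]
    by (auto simp: insert_commute)
qed auto

lemma mono_path_Cons:
  "mono_path c k (u # v # p) \<longleftrightarrow> (p \<noteq> [] \<longrightarrow> c {u, v, hd p} = k) \<and> mono_path c k (v # p)"
  by (cases p) auto

lemma mono_path_appendD2: "mono_path c k (xs @ ys) \<Longrightarrow> mono_path c k ys"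
proof (induction xs)
  case (Cons x xs)
  then show ?case
    by (cases "xs @ ys" rule: remdups_adj.cases) auto
qed simp

lemma mono_path_appendD1: "mono_path c k (xs @ ys) \<Longrightarrow> mono_path c k xs"
  by (metis mono_path_appendD2 mono_path_rev rev_append)

lemma mono_path_iff_nth:
  "mono_path c k p \<longleftrightarrow> (\<forall>i. i + 2 < length p \<longrightarrow> c {p ! i, p ! (i + 1), p ! (i + 2)} = k)"
proof (induction c k p rule: mono_path.induct)
  case (1 c k u v w p)
  have "(\<forall>i. Q i) \<longleftrightarrow> Q 0 \<and> (\<forall>i. Q (Suc i))" for Q :: "nat \<Rightarrow> bool"
    by (metis not0_implies_Suc)
  from this[of "\<lambda>i. i + 2 < length (u # v # w # p) \<longrightarrow>
    c {(u # v # w # p) ! i, (u # v # w # p) ! (i + 1), (u # v # w # p) ! (i + 2)} = k"]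
  show ?case
    using 1 by simp
qed auto

section \<open>Sequences that change colour once, at a pair of vertices shared by both parts\<close>

definition bicol_path :: "('a set \<Rightarrow> bool) \<Rightarrow> 'a list \<Rightarrow> bool" where
  "bicol_path c p \<longleftrightarrow> (\<exists>k xs u v ys. p = xs @ u # v # ys \<and>
     mono_path c k (xs @ [u, v]) \<and> mono_path c (\<not> k) (u # v # ys))"

lemma bicol_pathI:
  "mono_path c k (xs @ [u, v]) \<Longrightarrow> mono_path c (\<not> k) (u # v # ys) \<Longrightarrow> bicol_path c (xs @ u # v # ys)"
  unfolding bicol_path_def by blast

text \<open>Joining end to end creates only the triples \<open>u v y\<close> and
  \<open>v y z\<close>. Unless their colours are \<open>\<not> k\<close> and then \<open>k\<close>,
  the colour still changes at most once; the three cases turn at \<open>y z\<close>,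
  \<open>v y\<close> and \<open>u v\<close>.\<close>

lemma bicol_path_glue:
  assumes "mono_path c k (xs @ [u, v])" and "mono_path c (\<not> k) (y # z # zs)"
    and "\<not> (c {u, v, y} = (\<not> k) \<and> c {v, y, z} = k)"
  shows "bicol_path c (xs @ [u, v] @ [y, z] @ zs)"
proof -
  consider "c {u, v, y} = k" "c {v, y, z} = k" | "c {u, v, y} = k" "c {v, y, z} = (\<not> k)"
    | "c {u, v, y} = (\<not> k)" "c {v, y, z} = (\<not> k)"
    using assms(3) by blast
  then show ?thesis
  proof cases
    case 1
    then show ?thesis
      using bicol_pathI[of c k "xs @ [u, v]" y z zs] assms mono_path_append[of c k xs u v "[y, z]"]
      by simp
  next
    case 2
    then show ?thesis
      using bicol_pathI[of c k "xs @ [u]" v y "z # zs"] assms mono_path_append[of c k xs u v "[y]"]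
      by simp
  next
    case 3
    then show ?thesis
      using bicol_pathI[of c k xs u v "y # z # zs"] assms by simp
  qed
qed

section \<open>Inserting a vertex\<close>

lemma bicol_path_insert_red:
  assumes red: "mono_path c k (xs @ [a, b])" and blue: "mono_path c (\<not> k) (a # b # ys)"
    and abx: "c {a, b, x} = k"
  shows "\<exists>p. mset p = mset (x # xs @ a # b # ys) \<and> bicol_path c p"
proof (rule ccontr)
  assume "\<not> ?thesis"
  then have nb: "\<And>p. mset p = mset (x # xs @ a # b # ys) \<Longrightarrow> \<not> bicol_path c p"
    by blast
  have redx: "mono_path c k (xs @ [a, b, x])"
    using red abx mono_path_append[of c k xs a b "[x]"] by simp
  have "xs \<noteq> []"
  proof
    assume "xs = []"
    then have "bicol_path c ([x] @ a # b # ys)"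
      using bicol_pathI[of c k "[x]" a b ys] blue abx by (simp add: insert_commute)
    then show False using nb \<open>xs = []\<close> by simp
  qed
  then obtain s as where xs: "xs = s # as" by (cases xs) auto
  \<comment> \<open>With \<open>k\<close> as red, \<open>as\<close> is the A of the outline. Taking
    \<open>p\<close> from \<open>as @ [a]\<close> covers empty \<open>as\<close>, where
    \<open>p\<close> is \<open>a\<close>; \<open>rev ps @ [p, s]\<close> is \<open>a\<close>, then A
    reversed, then \<open>s\<close>.\<close>
  obtain p ps where sp: "as @ [a] = p # ps" by (cases "as @ [a]") auto
  have red': "mono_path c k (s # p # ps @ [b])"
    using red sp unfolding xs by (metis append_Cons append_assoc append_Nil)
  have "ys \<noteq> []"
  proof
    assume "ys = []"
    then have "bicol_path c ((xs @ [a]) @ b # x # [])"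
      using bicol_pathI[of c k "xs @ [a]" b x "[]"] redx by simp
    then show False using nb[of "xs @ [a, b, x]"] \<open>ys = []\<close> by simp
  qed
  moreover have "\<not> (\<exists>t. ys = [t])"
  proof
    assume "\<exists>t. ys = [t]"
    then obtain t where t: "ys = [t]" by blast
    \<comment> \<open>The colour of \<open>{b, x, t}\<close> decides whether the turn is at
      \<open>x t\<close> or at \<open>b x\<close>.\<close>
    have "bicol_path c (xs @ [a, b, x, t])"
    proof (cases "c {b, x, t} = k")
      case True
      then show ?thesis
        using bicol_pathI[of c k "xs @ [a, b]" x t "[]"] redx mono_path_append[of c k "xs @ [a]" b x "[t]"]
        by simp
    next
      case False
      then show ?thesis
        using bicol_pathI[of c k "xs @ [a]" b x "[t]"] redx by simp
    qed
    then show False using nb[of "xs @ [a, b, x, t]"] t by simp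
  qed
  \<comment> \<open>\<open>ys\<close> is read from both ends. The two views may overlap: if it has
    only two vertices, \<open>q\<close> is \<open>w\<close> and \<open>r\<close> is
    \<open>t\<close>.\<close>
  ultimately obtain q r zs where ys: "ys = q # r # zs"
    by (metis neq_Nil_conv)
  obtain us w t where ys': "ys = us @ [w, t]"
  proof -
    obtain vs t where "ys = vs @ [t]" using ys by (metis rev_exhaust list.distinct(1))
    moreover then obtain us w where "vs = us @ [w]" using ys by (cases vs rule: rev_cases) auto
    ultimately show ?thesis using that by simp
  qed
  have rblue: "mono_path c (\<not> k) (t # w # rev us)"
    using blue mono_path_rev[of c "\<not> k" ys] mono_path_appendD2[of c "\<not> k" "[a, b]" ys]
    by (simp add: ys')
  have bys: "mono_path c (\<not> k) (b # ys)"
    using blue mono_path_appendD2[of c "\<not> k" "[a]" "b # ys"] by simp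
  have "c {x, s, p} \<noteq> k"
  proof
    assume "c {x, s, p} = k"
    then have "bicol_path c ((x # xs) @ a # b # ys)"
      using bicol_pathI[of c k "x # xs" a b ys] blue red sp red' unfolding xs
      by (metis append_Cons append_assoc append_Nil mono_path.simps(1))
    then show False using nb by simp
  qed
  then have psx: "c {p, s, x} = (\<not> k)" by (auto simp: insert_commute)
  have redrev: "mono_path c k ((x # b # rev ps) @ [p, s])"
  proof -
    have "rev (xs @ [a, b, x]) = x # b # rev (as @ [a]) @ [s]"
      by (simp add: xs)
    also have "\<dots> = (x # b # rev ps) @ [p, s]"
      unfolding sp by simp
    finally have eq: "rev (xs @ [a, b, x]) = (x # b # rev ps) @ [p, s]" .
    show ?thesis
      using redx unfolding eq[symmetric] mono_path_rev .
  qed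
  have ms: "mset xs + {#a#} = {#s#} + {#p#} + mset ps"
    using arg_cong[OF sp, of mset] by (simp add: xs)
  \<comment> \<open>Gluing can fail only if both new triples have the excluded colours, so this one
    sequence fixes two colours.\<close>
  have pst: "c {p, s, t} = (\<not> k)" and stw: "c {s, t, w} = k"
    using bicol_path_glue[OF redrev rblue] nb[of "(x # b # rev ps) @ [p, s] @ [t, w] @ rev us"] ms
    by (auto simp: ys')
  have bxq: "c {b, x, q} = (\<not> k)"
  proof -
    have "mono_path c (\<not> k) (q # r # zs)"
      using mono_path_appendD2[of c "\<not> k" "[b]" ys] bys by (simp add: ys)
    then show ?thesis
      using bicol_path_glue[of c k "xs @ [a]" b x q r zs] redx
        nb[of "(xs @ [a]) @ [b, x] @ [q, r] @ zs"] by (auto simp: ys)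
  qed
  have bxt: "c {b, x, t} = (\<not> k)"
    using bicol_path_glue[of c k "xs @ [a]" b x t w "rev us"] redx rblue
      nb[of "(xs @ [a]) @ [b, x] @ [t, w] @ rev us"] by (auto simp: ys')
  have redps: "mono_path c k (rev ps @ [p, s])"
    using redrev mono_path_appendD2[of c k "[x, b]"] by simp
  have sxb: "c {s, x, b} = k"
  proof -
    have "mono_path c (\<not> k) (x # b # ys)"
      using bys bxq by (simp add: ys insert_commute)
    then show ?thesis
      using bicol_path_glue[OF redps, of x b ys] psx nb[of "rev ps @ [p, s] @ [x, b] @ ys"] ms
      by auto
  qed
  have xst: "c {x, s, t} = (\<not> k)"
  proof -
    have "mono_path c k (as @ [a, b, x])"
      using redx mono_path_appendD2[of c k "[s]"] by (simp add: xs)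
    then have "mono_path c k ((as @ [a, b]) @ [x, s])"
      using mono_path_append[of c k "as @ [a]" b x "[s]"] sxb by (simp add: insert_commute)
    then show ?thesis
      using bicol_path_glue[of c k "as @ [a, b]" x s t w "rev us"] rblue stw
        nb[of "(as @ [a, b]) @ [x, s] @ [t, w] @ rev us"] by (auto simp: ys' xs)
  qed
  have "hd (us @ [w]) = q"
    using ys ys' by (cases us) auto
  moreover have "mono_path c (\<not> k) (b # us @ [w])"
    using bys mono_path_appendD1[of c "\<not> k" "b # us @ [w]" "[t]"] by (simp add: ys')
  ultimately have "mono_path c (\<not> k) (t # x # b # us @ [w])"
    using bxq bxt by (simp add: mono_path_Cons insert_commute)
  \<comment> \<open>Both triples at the joint, \<open>p s t\<close> and \<open>s t x\<close>, have
    colour \<open>\<not> k\<close>, so this sequence turns at \<open>p s\<close>.\<close>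
  then have "bicol_path c (rev ps @ [p, s] @ [t, x] @ b # us @ [w])"
    using bicol_path_glue[OF redps] pst xst by (simp add: insert_commute)
  then show False
    using nb[of "rev ps @ [p, s] @ [t, x] @ b # us @ [w]"] ms by (auto simp: ys')
qed

text \<open>Equality of multisets lets distinctness and the vertex set be recovered afterwards
  instead of being carried through the rearrangements.\<close>

lemma bicol_path_insert:
  assumes "bicol_path c p"
  shows "\<exists>p'. mset p' = mset (x # p) \<and> bicol_path c p'"
proof -
  obtain k xs u v ys where p: "p = xs @ u # v # ys"
    and red: "mono_path c k (xs @ [u, v])" and blue: "mono_path c (\<not> k) (u # v # ys)"
    using assms unfolding bicol_path_def by blast
  show ?thesis
  proof (cases "c {u, v, x} = k")
    case True
    then show ?thesis using bicol_path_insert_red[OF red blue] p by simp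
  next
    case False
    \<comment> \<open>Reversal exchanges the two parts, so \<open>\<not> k\<close> now plays the
      role of red.\<close>
    have "mono_path c (\<not> k) (rev ys @ [v, u])" "mono_path c (\<not> \<not> k) (v # u # rev xs)"
      using red blue mono_path_rev[of c k "xs @ [u, v]"] mono_path_rev[of c "\<not> k" "u # v # ys"]
      by simp_all
    moreover have "c {v, u, x} = (\<not> k)"
      using False by (auto simp: insert_commute)
    ultimately show ?thesis using bicol_path_insert_red[of c "\<not> k" "rev ys" v u "rev xs" x] p
      by (simp add: add_mset_commute ac_simps)
  qed
qed

section \<open>Induction on the vertex set\<close>

lemma bicol_path_exists:
  assumes "finite V" and "card V \<ge> 2"
  shows "\<exists>p. distinct p \<and> set p = V \<and> bicol_path c p"
  using assms
proof (induction V rule: finite_induct)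
  case (insert x F)
  show ?case
  proof (cases "card F \<ge> 2")
    case True
    then obtain p where p: "distinct p" "set p = F" "bicol_path c p"
      using insert by blast
    obtain p' where p': "mset p' = mset (x # p)" "bicol_path c p'"
      using bicol_path_insert[OF p(3)] by blast
    have "distinct p'" "set p' = insert x F"
      using p p'(1) insert.hyps mset_eq_imp_distinct_iff[OF p'(1)] mset_eq_setD[OF p'(1)] by auto
    then show ?thesis using p'(2) by blast
  next
    case False
    then have "card F = 1" using insert by simp
    then obtain y where "F = {y}" by (auto simp: card_1_singleton_iff)
    \<comment> \<open>Actual start of the induction: two vertices contain no triple.\<close>
    then show ?thesis
      using bicol_pathI[of c True "[]" x y "[]"] insert.hyps
      by (intro exI[of _ "[x, y]"]) auto
  qed
qed simp

section \<open>Back to indexed edges\<close>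

lemma bicol_path_imp_bicoloured:
  assumes "bicol_path c p"
  shows "bicoloured c p"
proof -
  obtain k xs u v ys where p: "p = xs @ u # v # ys"
    and red: "mono_path c k (xs @ [u, v])" and blue: "mono_path c (\<not> k) (u # v # ys)"
    using assms unfolding bicol_path_def by blast
  have "c (path_edge p i) = k" if i: "i \<in> {2..length xs + 1}" for i
  proof -
    obtain j where j: "i = j + 2" using i le_Suc_ex[of 2 i] by auto
    have len: "j + 2 < length (xs @ [u, v])"
      using i by (simp add: j)
    then have "c {(xs @ [u, v]) ! j, (xs @ [u, v]) ! (j + 1), (xs @ [u, v]) ! (j + 2)} = k"
      using red unfolding mono_path_iff_nth by blast
    moreover have nth: "(xs @ [u, v]) ! m = p ! m" if "m \<le> j + 2" for m
      using that len by (simp add: p nth_append nth_Cons')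
    have "path_edge p i = {p ! j, p ! (j + 1), p ! (j + 2)}"
      by (simp add: path_edge_def j)
    then have "path_edge p i = {(xs @ [u, v]) ! j, (xs @ [u, v]) ! (j + 1), (xs @ [u, v]) ! (j + 2)}"
      by (simp only: nth)
    ultimately show ?thesis by simp
  qed
  moreover have "c (path_edge p i) = (\<not> k)" if i: "i \<in> {length xs + 1<..length p - 1}" for i
  proof -
    obtain j where j: "i = length xs + j + 2"
      using i by (auto dest!: less_imp_Suc_add)
    have "j + 2 < length (u # v # ys)"
      using i by (simp add: p j)
    then have "c {(u # v # ys) ! j, (u # v # ys) ! (j + 1), (u # v # ys) ! (j + 2)} = (\<not> k)"
      using blue unfolding mono_path_iff_nth by blast
    moreover have nth: "p ! (length xs + m) = (u # v # ys) ! m" for m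
      unfolding p by (rule nth_append_length_plus)
    have "path_edge p i = {p ! (length xs + j), p ! (length xs + (j + 1)), p ! (length xs + (j + 2))}"
      by (simp add: path_edge_def j)
    then have "path_edge p i = {(u # v # ys) ! j, (u # v # ys) ! (j + 1), (u # v # ys) ! (j + 2)}"
      unfolding nth .
    ultimately show ?thesis by simp
  qed
  \<comment> \<open>Edges are numbered by their middle vertex, counted from 1, and \<open>u\<close>
    has number \<open>length xs + 1\<close>; a triple centred at \<open>u\<close> still belongs to
    the first part.\<close>
  moreover have "length xs + 1 \<in> {1..length p - 1}" by (simp add: p)
  ultimately show ?thesis
    unfolding bicoloured_def by (intro disjI2 bexI[of _ "length xs + 1"] exI[of _ k] conjI ballI)
qed

lemma tight_path_complete3:
  assumes "p \<noteq> []" and "distinct p"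
  shows "tight_path (set p) (complete3_edges (set p)) p"
proof -
  have "path_edge p i \<in> complete3_edges (set p)" if "i \<in> {2..length p - 1}" for i
  proof -
    have "card (path_edge p i) = 3"
      using that assms by (auto simp: path_edge_def nth_eq_iff_index_eq card_insert_if)
    then show ?thesis
      using that by (auto simp: complete3_edges_def nsets_def path_edge_def)
  qed
  then show ?thesis using assms by (simp add: tight_path_def)
qed

theorem proposition7:
  fixes V :: "'a set" and n :: nat and c :: "'a set \<Rightarrow> bool"
  assumes "n \<ge> 1" and "finite V" and "card V = n"
  shows "\<exists>p. tight_path V (complete3_edges V) p \<and> spanning V p \<and> bicoloured c p"
proof -
  have "\<exists>p. p \<noteq> [] \<and> distinct p \<and> set p = V \<and> bicoloured c p"
  \<comment> \<open>A \<open>bicol_path\<close> has at least two vertices, so a single vertex is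
    treated apart.\<close>
  proof (cases "n = 1")
    case True
    then obtain v where "V = {v}" using assms by (auto simp: card_1_singleton_iff)
    then show ?thesis by (intro exI[of _ "[v]"]) (simp add: bicoloured_def)
  next
    case False
    then obtain p where "distinct p" "set p = V" "bicol_path c p"
      using bicol_path_exists[of V c] assms by auto
    then show ?thesis
      using assms bicol_path_imp_bicoloured[of c p] by (intro exI[of _ p]) auto
  qed
  then show ?thesis using tight_path_complete3 by (auto simp: spanning_def)
qed

end
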